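(* For any finite coloring of $\mathbb{N}$, there exist $a, b \in \mathbb{N}$ such that the set $\{a, b, ab, a(b+1)\}$ is monochromatic. That is, for every integer $r \geq 1$ and every partition $\mathbb{N} = A_1 \cup \cdots \cup A_r$ into pairwise disjoint sets, there exist $k \in \{1, \ldots, r\}$ and $a, b \in \mathbb{N}$ such that $\{a, b, ab, a(b+1)\} \subseteq A_k$.
   Context: Here $\mathbb{N} = \{1, 2, 3, \ldots\}$ denotes the set of positive integers. A finite coloring of $\mathbb{N}$ is a partition of $\mathbb{N}$ into finitely many pairwise disjoint sets (the color classes). A subset of $\mathbb{N}$ is monochromatic if it is entirely contained in one of the color classes. *)

theory Defs
  imports Main "HOL-Library.Disjoint_Sets"
begin

end

theory Submission
  imports Defs
begin

text \<open>
  Take an idempotent ultrafilter \<open>p\<close> on \<open>(\<nat>, +)\<close> containing the positive integers; it contains all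
  sets of multiples \<open>g\<nat>\<close>. For \<open>g \<ge> 1\<close>, colour the multiples \<open>m\<close> of \<open>g\<close> by the colour of \<open>m / g\<close>,
  and call the colour met on a set in \<open>p\<close> the limit colour of \<open>g\<close>. Some \<open>k\<close> is the limit colour of
  every element of a set in \<open>p\<close>. As in the proof of Schur's theorem one then finds
  \<open>g\<close>, \<open>f\<close>, \<open>h\<close> with \<open>g\<close> dividing \<open>f\<close> and \<open>f\<close> dividing \<open>h\<close> such that all of
  \<open>f / g\<close>, \<open>h / f\<close>, \<open>h / g\<close>, \<open>(f + h) / g\<close> have colour \<open>k\<close>.
  Now put \<open>a = f / g\<close> and \<open>b = h / f\<close>.
\<close>

section \<open>Filters and the existence of ultrafilters\<close>

definition proper_filter :: "'a set set \<Rightarrow> bool" where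
  "proper_filter F \<longleftrightarrow> UNIV \<in> F \<and> {} \<notin> F \<and> (\<forall>A\<in>F. \<forall>B\<in>F. A \<inter> B \<in> F)
     \<and> (\<forall>A\<in>F. \<forall>B. A \<subseteq> B \<longrightarrow> B \<in> F)"

definition ultrafilter :: "'a set set \<Rightarrow> bool" where
  "ultrafilter F \<longleftrightarrow> proper_filter F \<and> (\<forall>A. A \<in> F \<or> - A \<in> F)"

text \<open>On ultrafilters this is the sum in the Stone-Cech compactification. For a proper filter
  \<open>F\<close>, \<open>F \<subseteq> filter_plus F F\<close> makes the ultrafilters above
  \<open>F\<close> closed under sums, by \<open>filter_plus_mono\<close>; for an ultrafilter, being
  a maximal proper filter, it amounts to idempotence.\<close>

definition filter_plus :: "'a::plus set set \<Rightarrow> 'a set set \<Rightarrow> 'a set set" where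
  "filter_plus F G = {A. {x. {y. x + y \<in> A} \<in> G} \<in> F}"

lemma proper_filterD:
  assumes "proper_filter F"
  shows "UNIV \<in> F" "{} \<notin> F" "\<And>A B. A \<in> F \<Longrightarrow> B \<in> F \<Longrightarrow> A \<inter> B \<in> F"
    "\<And>A B. A \<in> F \<Longrightarrow> A \<subseteq> B \<Longrightarrow> B \<in> F"
  using assms by (auto simp: proper_filter_def)

lemma proper_filterI:
  assumes "UNIV \<in> F" "{} \<notin> F" "\<And>A B. A \<in> F \<Longrightarrow> B \<in> F \<Longrightarrow> A \<inter> B \<in> F"
    "\<And>A B. A \<in> F \<Longrightarrow> A \<subseteq> B \<Longrightarrow> B \<in> F"
  shows "proper_filter F"
  using assms by (auto simp: proper_filter_def)

lemma proper_filter_Union_chain: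
  assumes "C \<noteq> {}" and ch: "subset.chain S C" and S: "\<And>F. F \<in> S \<Longrightarrow> proper_filter F"
  shows "proper_filter (\<Union>C)"
proof -
  have pf: "proper_filter F" if "F \<in> C" for F
    using ch S that by (auto simp: subset.chain_def)
  show ?thesis
  proof (rule proper_filterI)
    obtain F where "F \<in> C" using \<open>C \<noteq> {}\<close> by blast
    then show "UNIV \<in> \<Union>C" using proper_filterD(1)[OF pf] by blast
    show "{} \<notin> \<Union>C" using proper_filterD(2)[OF pf] by blast
  next
    fix A B assume "A \<in> \<Union>C" "B \<in> \<Union>C"
    then obtain F G where FG: "F \<in> C" "G \<in> C" "A \<in> F" "B \<in> G" by blast
    then have "F \<subseteq> G \<or> G \<subseteq> F" using ch by (auto simp: subset.chain_def)
    then show "A \<inter> B \<in> \<Union>C"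
    proof
      assume "F \<subseteq> G"
      then show ?thesis using FG proper_filterD(3)[OF pf[OF FG(2)], of A B] by blast
    next
      assume "G \<subseteq> F"
      then show ?thesis using FG proper_filterD(3)[OF pf[OF FG(1)], of A B] by blast
    qed
  next
    fix A B assume "A \<in> \<Union>C" "A \<subseteq> B"
    then show "B \<in> \<Union>C" using proper_filterD(4)[OF pf] by blast
  qed
qed

text \<open>This is the filter generated by \<open>F\<close> and \<open>A\<close>: a
  \<open>B\<close> in \<open>F\<close> disjoint from \<open>A\<close> would put \<open>- A\<close>
  into \<open>F\<close>.\<close>

lemma proper_filter_extend:
  assumes F: "proper_filter F" and A: "- A \<notin> F"
  shows "proper_filter {X. \<exists>B\<in>F. B \<inter> A \<subseteq> X}"
proof (rule proper_filterI)
  show "UNIV \<in> {X. \<exists>B\<in>F. B \<inter> A \<subseteq> X}" using proper_filterD(1)[OF F] by blast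
  have "B \<inter> A \<noteq> {}" if "B \<in> F" for B
    using that A proper_filterD(4)[OF F, of B "- A"] by blast
  then show "{} \<notin> {X. \<exists>B\<in>F. B \<inter> A \<subseteq> X}" by blast
next
  fix X Y assume "X \<in> {X. \<exists>B\<in>F. B \<inter> A \<subseteq> X}" "Y \<in> {X. \<exists>B\<in>F. B \<inter> A \<subseteq> X}"
  then obtain B C where "B \<in> F" "C \<in> F" "B \<inter> A \<subseteq> X" "C \<inter> A \<subseteq> Y" by blast
  then have "B \<inter> C \<in> F" "(B \<inter> C) \<inter> A \<subseteq> X \<inter> Y" using proper_filterD(3)[OF F] by auto
  then show "X \<inter> Y \<in> {X. \<exists>B\<in>F. B \<inter> A \<subseteq> X}" by blast
qed blast

text \<open>A maximal proper filter above \<open>F\<close> decides every \<open>A\<close>, because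
  adjoining an \<open>A\<close> whose complement is absent cannot enlarge it.\<close>

lemma ultrafilter_exists:
  assumes F: "proper_filter F"
  obtains U where "ultrafilter U" "F \<subseteq> U"
proof -
  let ?S = "{G. proper_filter G \<and> F \<subseteq> G}"
  have "\<exists>M\<in>?S. \<forall>X\<in>?S. M \<subseteq> X \<longrightarrow> X = M"
  proof (rule subset_Zorn_nonempty)
    show "?S \<noteq> {}" using F by blast
    fix C assume C: "C \<noteq> {}" "subset.chain ?S C"
    then have "proper_filter (\<Union>C)" by (rule proper_filter_Union_chain) simp
    moreover have "F \<subseteq> \<Union>C" using C by (fastforce simp: subset.chain_def)
    ultimately show "\<Union>C \<in> ?S" by blast
  qed
  then obtain U where U: "proper_filter U" "F \<subseteq> U"
    and max: "\<And>G. proper_filter G \<Longrightarrow> F \<subseteq> G \<Longrightarrow> U \<subseteq> G \<Longrightarrow> G = U" by auto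
  have "A \<in> U" if A: "- A \<notin> U" for A
  proof -
    let ?G = "{X. \<exists>B\<in>U. B \<inter> A \<subseteq> X}"
    have "U \<subseteq> ?G" by blast
    with max[OF proper_filter_extend[OF U(1) A]] U(2) have "?G = U" by blast
    moreover have "A \<in> ?G" using proper_filterD(1)[OF U(1)] by blast
    ultimately show ?thesis by blast
  qed
  with U that show ?thesis unfolding ultrafilter_def by blast
qed

section \<open>Sums of filters and idempotent ultrafilters\<close>

lemma filter_plus_iff: "A \<in> filter_plus F G \<longleftrightarrow> {x. {y. x + y \<in> A} \<in> G} \<in> F"
  by (simp add: filter_plus_def)

lemma proper_filter_plus:
  assumes F: "proper_filter F" and G: "proper_filter G"
  shows "proper_filter (filter_plus F G)"
proof (rule proper_filterI)
  show "UNIV \<in> filter_plus F G" "{} \<notin> filter_plus F G"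
    using proper_filterD(1,2)[OF F] proper_filterD(1,2)[OF G] by (simp_all add: filter_plus_iff)
next
  fix A B assume "A \<in> filter_plus F G" "B \<in> filter_plus F G"
  then have *: "{x. {y. x + y \<in> A} \<in> G} \<inter> {x. {y. x + y \<in> B} \<in> G} \<in> F"
    using proper_filterD(3)[OF F] by (simp add: filter_plus_iff)
  have "{y. x + y \<in> A \<inter> B} \<in> G" if "{y. x + y \<in> A} \<in> G" "{y. x + y \<in> B} \<in> G" for x
    using proper_filterD(3)[OF G that] by (simp add: Collect_conj_eq)
  then show "A \<inter> B \<in> filter_plus F G"
    unfolding filter_plus_iff by (intro proper_filterD(4)[OF F *]) blast
next
  fix A B assume A: "A \<in> filter_plus F G" and "A \<subseteq> B"
  have "{y. x + y \<in> B} \<in> G" if "{y. x + y \<in> A} \<in> G" for x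
    using that by (rule proper_filterD(4)[OF G]) (use \<open>A \<subseteq> B\<close> in blast)
  then show "B \<in> filter_plus F G"
    using A unfolding filter_plus_iff by (elim proper_filterD(4)[OF F]) blast
qed

lemma filter_plus_mono:
  assumes "proper_filter F" "F \<subseteq> F'" "G \<subseteq> G'"
  shows "filter_plus F G \<subseteq> filter_plus F' G'"
proof
  fix A assume "A \<in> filter_plus F G"
  then have "{x. {y. x + y \<in> A} \<in> G} \<in> F" by (simp add: filter_plus_iff)
  then have "{x. {y. x + y \<in> A} \<in> G'} \<in> F"
    by (rule proper_filterD(4)[OF assms(1)]) (use assms(3) in blast)
  with assms(2) show "A \<in> filter_plus F' G'" by (auto simp: filter_plus_iff)
qed

lemma filter_plus_assoc:
  fixes F :: "'a::semigroup_add set set"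
  shows "filter_plus (filter_plus F G) H = filter_plus F (filter_plus G H)"
  by (simp add: filter_plus_def add.assoc)

text \<open>
  Filters correspond to closed subsets of the space of ultrafilters, with the inclusion reversed, so
  this is the Ellis--Numakura lemma: \<open>F\<close> plays the role of a minimal closed subsemigroup \<open>S\<close>, and
  the two closed subsemigroups of \<open>S\<close> considered are \<open>S + U\<close> and the set of \<open>V\<close> with \<open>V + U = U\<close>.
\<close>

lemma idempotent_ultrafilter_exists:
  fixes F0 :: "'a::semigroup_add set set"
  assumes F0: "proper_filter F0" "F0 \<subseteq> filter_plus F0 F0"
  obtains U where "ultrafilter U" "F0 \<subseteq> U" "U \<subseteq> filter_plus U U"
proof -
  let ?S = "{G. proper_filter G \<and> F0 \<subseteq> G \<and> G \<subseteq> filter_plus G G}"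
  have "\<exists>M\<in>?S. \<forall>X\<in>?S. M \<subseteq> X \<longrightarrow> X = M"
  proof (rule subset_Zorn_nonempty)
    show "?S \<noteq> {}" using F0 by blast
    fix C assume C: "C \<noteq> {}" "subset.chain ?S C"
    then have "proper_filter (\<Union>C)" by (rule proper_filter_Union_chain) simp
    moreover have "F0 \<subseteq> \<Union>C" using C by (fastforce simp: subset.chain_def)
    moreover have "G \<subseteq> filter_plus (\<Union>C) (\<Union>C)" if "G \<in> C" for G
    proof -
      have "proper_filter G" "G \<subseteq> filter_plus G G"
        using C that by (auto simp: subset.chain_def)
      with filter_plus_mono[of G "\<Union>C" G "\<Union>C"] that show ?thesis by blast
    qed
    ultimately show "\<Union>C \<in> ?S" by blast
  qed
  then obtain F where F: "proper_filter F" "F0 \<subseteq> F" "F \<subseteq> filter_plus F F"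
    and max: "\<And>G. proper_filter G \<Longrightarrow> F \<subseteq> G \<Longrightarrow> G \<subseteq> filter_plus G G \<Longrightarrow> G = F"
    by (auto dest: subset_trans)
  obtain U where U: "ultrafilter U" "F \<subseteq> U" by (rule ultrafilter_exists[OF F(1)])
  then have pU: "proper_filter U" by (simp add: ultrafilter_def)

  \<comment> \<open>That is, \<open>S + U = S\<close>, so some \<open>V\<close> in \<open>S\<close>
    has \<open>V + U = U\<close>; \<open>q_pos\<close> below is the filter form of this
    existence.\<close>
  have FU: "filter_plus F U = F"
  proof (rule max)
    show "proper_filter (filter_plus F U)" by (rule proper_filter_plus[OF F(1) pU])
    show sub: "F \<subseteq> filter_plus F U" using filter_plus_mono[OF F(1), of F F U] F(3) U(2) by blast
    have "filter_plus F U \<subseteq> filter_plus (filter_plus F F) U"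
      by (rule filter_plus_mono[OF F(1,3)]) simp
    also have "\<dots> = filter_plus F (filter_plus F U)" by (rule filter_plus_assoc)
    also have "\<dots> \<subseteq> filter_plus (filter_plus F U) (filter_plus F U)"
      by (rule filter_plus_mono[OF F(1) sub]) simp
    finally show "filter_plus F U \<subseteq> filter_plus (filter_plus F U) (filter_plus F U)" .
  qed

  \<comment> \<open>An ultrafilter \<open>V\<close> satisfies \<open>V + U = U\<close> exactly when
    it contains \<open>q C\<close> for every \<open>C\<close> in \<open>U\<close>.\<close>
  define q where "q C = {x. {y. x + y \<in> C} \<in> U}" for C
  have q_Int: "q (C \<inter> D) \<subseteq> q C \<inter> q D" for C D
    unfolding q_def by (auto elim: proper_filterD(4)[OF pU])
  have q_shift: "{y. x + y \<in> q C} = q {y. x + y \<in> C}" for x C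
    by (simp add: q_def add.assoc)
  \<comment> \<open>Otherwise \<open>- C\<close> would lie in \<open>filter_plus F U\<close>, which
    is \<open>F\<close>, hence in \<open>U\<close> together with \<open>C\<close>.\<close>
  have q_pos: "B \<inter> q C \<noteq> {}" if B: "B \<in> F" and C: "C \<in> U" for B C
  proof
    assume "B \<inter> q C = {}"
    have "{y. x + y \<in> - C} \<in> U" if "x \<notin> q C" for x
    proof -
      have "- {y. x + y \<in> C} \<in> U" using that U(1) by (auto simp: q_def ultrafilter_def)
      then show ?thesis by (simp add: Collect_neg_eq)
    qed
    with \<open>B \<inter> q C = {}\<close> have "B \<subseteq> {x. {y. x + y \<in> - C} \<in> U}" by blast
    with B have "- C \<in> filter_plus F U"
      unfolding filter_plus_def using proper_filterD(4)[OF F(1)] by blast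
    with FU U(2) C have "C \<inter> - C \<in> U" using proper_filterD(3)[OF pU] by blast
    then show False using proper_filterD(2)[OF pU] by simp
  qed
  \<comment> \<open>The filter generated by \<open>F\<close> and all \<open>q C\<close>; it stands
    for the set of \<open>V\<close> in \<open>S\<close> with \<open>V + U = U\<close>.\<close>
  define T where "T = {A. \<exists>B\<in>F. \<exists>C\<in>U. B \<inter> q C \<subseteq> A}"
  have T_I: "A \<in> T" if "B \<in> F" "C \<in> U" "B \<inter> q C \<subseteq> A" for A B C
    using that by (auto simp: T_def)
  have "T = F"
  proof (rule max)
    show "F \<subseteq> T" using T_I[OF _ proper_filterD(1)[OF pU]] by blast
    show "proper_filter T"
    proof (rule proper_filterI)
      show "UNIV \<in> T" using T_I[OF proper_filterD(1)[OF F(1)] proper_filterD(1)[OF pU]] by blast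
      show "{} \<notin> T" using q_pos by (auto simp: T_def)
    next
      fix A A' assume "A \<in> T" "A' \<in> T"
      then obtain B C B' C' where "B \<in> F" "C \<in> U" "B \<inter> q C \<subseteq> A" "B' \<in> F" "C' \<in> U" "B' \<inter> q C' \<subseteq> A'"
        unfolding T_def by blast
      then show "A \<inter> A' \<in> T"
        using proper_filterD(3)[OF F(1)] proper_filterD(3)[OF pU]
        by (intro T_I[of "B \<inter> B'" "C \<inter> C'"]) (use q_Int[of C C'] in auto)
    next
      fix A A' assume "A \<in> T" "A \<subseteq> A'"
      then show "A' \<in> T" unfolding T_def by blast
    qed
    show "T \<subseteq> filter_plus T T"
    proof
      fix A assume "A \<in> T"
      then obtain B C where BC: "B \<in> F" "C \<in> U" "B \<inter> q C \<subseteq> A" unfolding T_def by blast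
      \<comment> \<open>For \<open>x\<close> in \<open>q C\<close> the translate of \<open>C\<close>
        by \<open>x\<close> is again in \<open>U\<close>, and \<open>q\<close> commutes with
        translation, so the translate of \<open>B \<inter> q C\<close> is again a generator of
        \<open>T\<close>.\<close>
      have "{y. x + y \<in> A} \<in> T" if "{y. x + y \<in> B} \<in> F" "x \<in> q C" for x
      proof (rule T_I[OF that(1)])
        show "{y. x + y \<in> C} \<in> U" using that(2) by (simp add: q_def)
        show "{y. x + y \<in> B} \<inter> q {y. x + y \<in> C} \<subseteq> {y. x + y \<in> A}"
          using BC(3) unfolding q_shift[symmetric] by blast
      qed
      moreover have "{x. {y. x + y \<in> B} \<in> F} \<in> F"
        using BC(1) F(3) by (auto simp: filter_plus_def)
      ultimately have "{x. {y. x + y \<in> A} \<in> T} \<in> T"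
        by (intro T_I[OF _ BC(2)]) auto
      then show "A \<in> filter_plus T T" by (simp add: filter_plus_def)
    qed
  qed
  have "U \<subseteq> filter_plus U U"
  proof
    fix C assume "C \<in> U"
    then have "q C \<in> T" using T_I[OF proper_filterD(1)[OF F(1)]] by blast
    with \<open>T = F\<close> U(2) show "C \<in> filter_plus U U" by (auto simp: filter_plus_def q_def)
  qed
  with U F(2) that show ?thesis by blast
qed

section \<open>Pigeonhole for ultrafilters and consequences of idempotence\<close>

lemma ultrafilter_finite_Union:
  assumes U: "ultrafilter U" and "finite I" "(\<Union>i\<in>I. A i) \<in> U"
  shows "\<exists>i\<in>I. A i \<in> U"
  using assms(2,3)
proof (induction I)
  case empty
  then show ?case using U by (simp add: ultrafilter_def proper_filter_def)
next
  case (insert i I)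
  have pU: "proper_filter U" using U by (simp add: ultrafilter_def)
  show ?case
  proof (cases "A i \<in> U")
    case False
    then have "- A i \<in> U" using U by (auto simp: ultrafilter_def)
    with insert.prems have "(\<Union>j\<in>insert i I. A j) \<inter> - A i \<in> U" by (intro proper_filterD(3)[OF pU])
    then have "(\<Union>j\<in>I. A j) \<in> U" by (rule proper_filterD(4)[OF pU]) auto
    with insert.IH show ?thesis by blast
  qed simp
qed

text \<open>The source of Schur triples: any \<open>y\<close> in \<open>A\<close> and in the
  translate, a set of \<open>U\<close>, gives \<open>x\<close>, \<open>y\<close>,
  \<open>x + y\<close> in \<open>A\<close>.\<close>

lemma idempotent_ultrafilter_sum:
  assumes U: "ultrafilter U" "U \<subseteq> filter_plus U U" and A: "A \<in> U"
  obtains x where "x \<in> A" "{y. x + y \<in> A} \<in> U"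
proof -
  have pU: "proper_filter U" using U by (simp add: ultrafilter_def)
  have "A \<inter> {x. {y. x + y \<in> A} \<in> U} \<in> U"
    using U(2) A by (intro proper_filterD(3)[OF pU]) (auto simp: filter_plus_def)
  then have "A \<inter> {x. {y. x + y \<in> A} \<in> U} \<noteq> {}" using proper_filterD(2)[OF pU] by metis
  with that show ?thesis by blast
qed

text \<open>Some residue class modulo \<open>g\<close> belongs to \<open>U\<close>; it contains
  \<open>x\<close>, \<open>y\<close> and \<open>x + y\<close> for suitable \<open>x\<close> and
  \<open>y\<close>, so it is the class of 0.\<close>

lemma idempotent_ultrafilter_multiples:
  fixes U :: "nat set set"
  assumes U: "ultrafilter U" "U \<subseteq> filter_plus U U" and "g > 0"
  shows "{m. g dvd m} \<in> U"
proof -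
  have pU: "proper_filter U" using U by (simp add: ultrafilter_def)
  have "(\<Union>i\<in>{..<g}. {m. m mod g = i}) = UNIV" using \<open>g > 0\<close> by auto
  with proper_filterD(1)[OF pU] obtain i where i: "{m. m mod g = i} \<in> U"
    using ultrafilter_finite_Union[OF U(1), of "{..<g}" "\<lambda>i. {m. m mod g = i}"] by auto
  from idempotent_ultrafilter_sum[OF U i] obtain x
    where x: "x mod g = i" "{y. (x + y) mod g = i} \<in> U" by auto
  have "{m. m mod g = i} \<inter> {y. (x + y) mod g = i} \<in> U" using i x(2) by (rule proper_filterD(3)[OF pU])
  then have "{m. m mod g = i} \<inter> {y. (x + y) mod g = i} \<noteq> {}" using proper_filterD(2)[OF pU] by metis
  then obtain y where y: "y mod g = i" "(x + y) mod g = i" by blast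
  have "g dvd (x + y) - x" using x(1) y(2) mod_eq_dvd_iff_nat[of x "x + y" g] by simp
  then have "y mod g = 0" by simp
  with y(1) i show ?thesis by (simp add: dvd_eq_mod_eq_0)
qed

theorem theorem1:
  fixes r :: nat and A :: "nat \<Rightarrow> nat set"
  assumes "r \<ge> 1"
    and "(\<Union>i\<in>{1..r}. A i) = {n. n \<ge> 1}"
    and "disjoint_family_on A {1..r}"
  shows "\<exists>k\<in>{1..r}. \<exists>a b. a \<ge> 1 \<and> b \<ge> 1 \<and> {a, b, a * b, a * (b + 1)} \<subseteq> A k"
proof -
  \<comment> \<open>Starting from the positive integers excludes the principal ultrafilter at 0,
    which is idempotent too.\<close>
  let ?N = "{n::nat. n > 0}" let ?F = "{X. ?N \<subseteq> X}"
  have "?F \<subseteq> filter_plus ?F ?F" by (auto simp: filter_plus_def)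
  moreover have "proper_filter ?F" by (auto simp: proper_filter_def)
  ultimately obtain U where U: "ultrafilter U" "U \<subseteq> filter_plus U U" and "?F \<subseteq> U"
    using idempotent_ultrafilter_exists by metis
  then have pU: "proper_filter U" and NU: "?N \<in> U" by (auto simp: ultrafilter_def)

  define E where "E g k = {m. g dvd m \<and> m div g \<in> A k}" for g k
  have "\<exists>k\<in>{1..r}. E g k \<in> U" if "g > 0" for g
  proof (rule ultrafilter_finite_Union[OF U(1)])
    \<comment> \<open>The multiple 0 is removed because its quotient 0 has no colour.\<close>
    have "{m. g dvd m} \<inter> ?N \<in> U"
      using idempotent_ultrafilter_multiples[OF U that] NU by (rule proper_filterD(3)[OF pU])
    moreover have "{m. g dvd m} \<inter> ?N \<subseteq> (\<Union>k\<in>{1..r}. E g k)"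
    proof
      fix m assume "m \<in> {m. g dvd m} \<inter> ?N"
      then have "g dvd m" "m div g \<ge> 1" 
        using that by (auto simp: Suc_le_eq div_greater_zero_iff dvd_imp_le)
      then have "m div g \<in> (\<Union>i\<in>{1..r}. A i)" using assms(2) by blast
      with \<open>g dvd m\<close> show "m \<in> (\<Union>k\<in>{1..r}. E g k)" by (auto simp: E_def)
    qed
    ultimately show "(\<Union>k\<in>{1..r}. E g k) \<in> U" by (rule proper_filterD(4)[OF pU])
  qed simp
  then have "?N \<subseteq> (\<Union>k\<in>{1..r}. {g. g > 0 \<and> E g k \<in> U})" by blast
  with NU have "(\<Union>k\<in>{1..r}. {g. g > 0 \<and> E g k \<in> U}) \<in> U" by (rule proper_filterD(4)[OF pU])
  from ultrafilter_finite_Union[OF U(1) _ this] obtain k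
    where k: "k \<in> {1..r}" and G: "{g. g > 0 \<and> E g k \<in> U} \<in> U" by auto
  then obtain g where g: "g > 0" "E g k \<in> U"
    using proper_filterD(2)[OF pU] by (metis (mono_tags, lifting) Collect_empty_eq)
  \<comment> \<open>Membership in \<open>E g k\<close> colours \<open>f / g\<close>,
    \<open>h / g\<close> and \<open>(f + h) / g\<close>; the limit colour \<open>k\<close> of
    \<open>f\<close> allows \<open>h / f\<close> to be given colour \<open>k\<close> as
    well.\<close>
  define B where "B = {g. g > 0 \<and> E g k \<in> U} \<inter> E g k"
  have B: "B \<in> U" unfolding B_def using G g(2) by (rule proper_filterD(3)[OF pU])
  then obtain f where f: "f \<in> B" "{y. f + y \<in> B} \<in> U"
    using idempotent_ultrafilter_sum[OF U] by blast
  then have "E f k \<in> U" by (simp add: B_def)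
  with B f(2) have "B \<inter> {y. f + y \<in> B} \<inter> E f k \<in> U" by (intro proper_filterD(3)[OF pU])
  then have "B \<inter> {y. f + y \<in> B} \<inter> E f k \<noteq> {}" using proper_filterD(2)[OF pU] by metis
  then obtain h where h: "h \<in> B" "f + h \<in> B" "h \<in> E f k" by blast
  have "g dvd f" "f dvd h" using f(1) h(3) by (auto simp: B_def E_def)
  then obtain a b where a: "f = g * a" and b: "h = f * b" by (auto elim!: dvdE)
  have fpos: "f > 0" and hpos: "h > 0" using f(1) h(1) by (auto simp: B_def)
  \<comment> \<open>Dividing by \<open>g\<close> turns the sum \<open>f + h\<close> into
    \<open>a + a * b\<close>, the element \<open>a * (b + 1)\<close>.\<close>
  have "f + h = g * (a * (b + 1))" "h = g * (a * b)" using a b by (auto simp: algebra_simps)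
  then have "{a, b, a * b, a * (b + 1)} \<subseteq> A k"
    using f(1) h g(1) fpos a b unfolding B_def E_def by auto
  moreover have "a \<ge> 1" "b \<ge> 1" using fpos hpos a b by (auto simp: Suc_le_eq)
  ultimately show ?thesis using k by blast
qed

end
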